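(* Let $\Gamma$ be a group which acts freely on a set $\Gamma'$. Let $R$ be a $\Gamma$-graded division ring and $M$ be a $\Gamma'$-graded module over $R$. Then $M$ is a graded free $R$-module. More generally, any linearly independent subset of $M$ consisting of homogeneous elements can be extended to form a homogeneous basis of $M$.
   Context: $\Gamma$ is an arbitrary (multiplicative, not necessarily abelian) group. A left action of $\Gamma$ on $\Gamma'$ is free if $\gamma\delta=\gamma'\delta$ for $\gamma,\gamma'\in\Gamma$, $\delta\in\Gamma'$ implies $\gamma=\gamma'$. A $\Gamma$-graded ring is $R=\bigoplus_{\gamma\in\Gamma}R_\gamma$ with additive subgroups satisfying $R_\gamma R_\delta\subseteq R_{\gamma\delta}$; it is a graded division ring if every non-zero homogeneous element (element of some $R_\gamma$) has a multiplicative inverse. A $\Gamma'$-graded (left) $R$-module is a left $R$-module $M=\bigoplus_{\lambda\in\Gamma'}M_\lambda$ with additive subgroups $M_\lambda$ satisfying $R_\gamma M_\lambda\subseteq M_{\gamma\lambda}$; homogeneous elements are those in $\bigcup_\lambda M_\lambda$. $M$ is graded free if it is free as an $R$-module with a basis consisting of homogeneous elements (a homogeneous basis). *)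

theory Defs
  imports "HOL-Algebra.Algebra"
begin

locale free_action = group_action +
  assumes free: "\<lbrakk>g \<in> carrier G; h \<in> carrier G; x \<in> E; \<phi> g x = \<phi> h x\<rbrakk> \<Longrightarrow> g = h"

text \<open>The locale \<open>module\<close> of HOL-Algebra requires a commutative ring of scalars. The following
  locale has the same axioms, but over an arbitrary unital ring.\<close>

locale left_module = R?: ring R + M?: abelian_group M
  for R :: "('r, 'u) ring_scheme" (structure) and M :: "('r, 'm, 'v) module_scheme" (structure) +
  assumes smult_closed [simp, intro]:
      "\<lbrakk>a \<in> carrier R; x \<in> carrier M\<rbrakk> \<Longrightarrow> a \<odot>\<^bsub>M\<^esub> x \<in> carrier M"
    and smult_l_distr:
      "\<lbrakk>a \<in> carrier R; b \<in> carrier R; x \<in> carrier M\<rbrakk> \<Longrightarrow>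
        (a \<oplus>\<^bsub>R\<^esub> b) \<odot>\<^bsub>M\<^esub> x = a \<odot>\<^bsub>M\<^esub> x \<oplus>\<^bsub>M\<^esub> b \<odot>\<^bsub>M\<^esub> x"
    and smult_r_distr:
      "\<lbrakk>a \<in> carrier R; x \<in> carrier M; y \<in> carrier M\<rbrakk> \<Longrightarrow>
        a \<odot>\<^bsub>M\<^esub> (x \<oplus>\<^bsub>M\<^esub> y) = a \<odot>\<^bsub>M\<^esub> x \<oplus>\<^bsub>M\<^esub> a \<odot>\<^bsub>M\<^esub> y"
    and smult_assoc1:
      "\<lbrakk>a \<in> carrier R; b \<in> carrier R; x \<in> carrier M\<rbrakk> \<Longrightarrow>
        (a \<otimes>\<^bsub>R\<^esub> b) \<odot>\<^bsub>M\<^esub> x = a \<odot>\<^bsub>M\<^esub> (b \<odot>\<^bsub>M\<^esub> x)"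
    and smult_one [simp]: "x \<in> carrier M \<Longrightarrow> \<one>\<^bsub>R\<^esub> \<odot>\<^bsub>M\<^esub> x = x"

text \<open>Only the additive structure of the first argument is used, so that both rings and modules
  can be decomposed. The sum is taken over the support, because \<open>finsum\<close> over an infinite index
  set is zero by convention.\<close>

definition internal_direct_sum :: "('a, 'b) ring_scheme \<Rightarrow> 'i set \<Rightarrow> ('i \<Rightarrow> 'a set) \<Rightarrow> bool"
  where "internal_direct_sum A I C \<longleftrightarrow>
    (\<forall>i\<in>I. additive_subgroup (C i) A) \<and>
    (\<forall>x\<in>carrier A. \<exists>!f. f \<in> (\<Pi>\<^sub>E i\<in>I. C i) \<and> finite {i \<in> I. f i \<noteq> \<zero>\<^bsub>A\<^esub>} \<and>
      x = (\<Oplus>\<^bsub>A\<^esub>i\<in>{i \<in> I. f i \<noteq> \<zero>\<^bsub>A\<^esub>}. f i))"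

locale graded_ring = grading: group \<Gamma> + ring R
  for \<Gamma> :: "('g, 'w) monoid_scheme" and R :: "('r, 'u) ring_scheme" (structure) +
  fixes Rg :: "'g \<Rightarrow> 'r set"
  assumes ring_direct_sum: "internal_direct_sum R (carrier \<Gamma>) Rg"
    and graded_mult:
      "\<lbrakk>g \<in> carrier \<Gamma>; h \<in> carrier \<Gamma>; a \<in> Rg g; b \<in> Rg h\<rbrakk> \<Longrightarrow> a \<otimes>\<^bsub>R\<^esub> b \<in> Rg (g \<otimes>\<^bsub>\<Gamma>\<^esub> h)"

locale graded_division_ring = graded_ring +
  assumes homogeneous_Units:
    "\<lbrakk>g \<in> carrier \<Gamma>; a \<in> Rg g; a \<noteq> \<zero>\<^bsub>R\<^esub>\<rbrakk> \<Longrightarrow> a \<in> Units R"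

locale graded_module =
  group_action \<Gamma> \<Gamma>' act + graded_ring \<Gamma> R Rg + left_module R M
  for \<Gamma> :: "('g, 'w) monoid_scheme" and \<Gamma>' :: "'l set" and act :: "'g \<Rightarrow> 'l \<Rightarrow> 'l"
    and R :: "('r, 'u) ring_scheme" (structure) and Rg :: "'g \<Rightarrow> 'r set"
    and M :: "('r, 'm, 'v) module_scheme" (structure) +
  fixes Mg :: "'l \<Rightarrow> 'm set"
  assumes module_direct_sum: "internal_direct_sum M \<Gamma>' Mg"
    and graded_smult:
      "\<lbrakk>g \<in> carrier \<Gamma>; l \<in> \<Gamma>'; a \<in> Rg g; x \<in> Mg l\<rbrakk> \<Longrightarrow> a \<odot>\<^bsub>M\<^esub> x \<in> Mg (act g l)"

definition lin_independent ::
    "('r, 'u) ring_scheme \<Rightarrow> ('r, 'm, 'v) module_scheme \<Rightarrow> 'm set \<Rightarrow> bool"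
  where "lin_independent R M S \<longleftrightarrow> S \<subseteq> carrier M \<and>
    (\<forall>A c. finite A \<and> A \<subseteq> S \<and> c \<in> A \<rightarrow> carrier R \<and>
      (\<Oplus>\<^bsub>M\<^esub>x\<in>A. c x \<odot>\<^bsub>M\<^esub> x) = \<zero>\<^bsub>M\<^esub> \<longrightarrow> (\<forall>x\<in>A. c x = \<zero>\<^bsub>R\<^esub>))"

definition lin_span ::
    "('r, 'u) ring_scheme \<Rightarrow> ('r, 'm, 'v) module_scheme \<Rightarrow> 'm set \<Rightarrow> 'm set"
  where "lin_span R M S =
    {(\<Oplus>\<^bsub>M\<^esub>x\<in>A. c x \<odot>\<^bsub>M\<^esub> x) | A c. finite A \<and> A \<subseteq> S \<and> c \<in> A \<rightarrow> carrier R}"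

definition module_basis ::
    "('r, 'u) ring_scheme \<Rightarrow> ('r, 'm, 'v) module_scheme \<Rightarrow> 'm set \<Rightarrow> bool"
  where "module_basis R M B \<longleftrightarrow> lin_independent R M B \<and> lin_span R M B = carrier M"

definition homogeneous_elements :: "'l set \<Rightarrow> ('l \<Rightarrow> 'm set) \<Rightarrow> 'm set"
  where "homogeneous_elements \<Gamma>' Mg = (\<Union>l\<in>\<Gamma>'. Mg l)"

definition homogeneous_basis ::
    "('r, 'u) ring_scheme \<Rightarrow> ('r, 'm, 'v) module_scheme \<Rightarrow> 'l set \<Rightarrow> ('l \<Rightarrow> 'm set) \<Rightarrow> 'm set \<Rightarrow> bool"
  where "homogeneous_basis R M \<Gamma>' Mg B \<longleftrightarrow>
    module_basis R M B \<and> B \<subseteq> homogeneous_elements \<Gamma>' Mg"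

definition graded_free ::
    "('r, 'u) ring_scheme \<Rightarrow> ('r, 'm, 'v) module_scheme \<Rightarrow> 'l set \<Rightarrow> ('l \<Rightarrow> 'm set) \<Rightarrow> bool"
  where "graded_free R M \<Gamma>' Mg \<longleftrightarrow> (\<exists>B. homogeneous_basis R M \<Gamma>' Mg B)"

end

theory Submission
  imports Defs
begin

text \<open>By Zorn's lemma choose a maximal linearly independent set \<open>B\<close> of homogeneous elements
  containing the given one. It suffices that every homogeneous \<open>m\<close> of degree \<open>l\<close> lies in the span
  of \<open>B\<close>. Otherwise maximality gives a relation \<open>c m + \<Sum> c\<^sub>x x = 0\<close> with \<open>c \<noteq> 0\<close>. Pick \<open>g\<close> such that
  the component \<open>c\<^sub>g\<close> of \<open>c\<close> is nonzero and take the components of degree \<open>g l\<close>: each \<open>c\<^sub>x x\<close>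
  contributes a multiple of \<open>x\<close>, and since the action is free, \<open>c m\<close> contributes exactly \<open>c\<^sub>g m\<close>. As
  \<open>c\<^sub>g\<close> is invertible, \<open>m\<close> lies in the span of \<open>B\<close> after all.\<close>

subsection \<open>Components in an internal direct sum\<close>

locale direct_sum = abelian_group +
  fixes I :: "'i set" and C :: "'i \<Rightarrow> 'a set"
  assumes internal_direct_sum: "internal_direct_sum G I C"
begin

text \<open>Uniqueness is a property of the whole family, so the family is described first and then
  evaluated at \<open>i\<close>.\<close>

definition component :: "'i \<Rightarrow> 'a \<Rightarrow> 'a"
  where "component i x = (THE f. f \<in> (\<Pi>\<^sub>E i\<in>I. C i) \<and> finite {i \<in> I. f i \<noteq> \<zero>} \<and>
    x = (\<Oplus>i\<in>{i \<in> I. f i \<noteq> \<zero>}. f i)) i"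

lemma summand_subgroup: "i \<in> I \<Longrightarrow> additive_subgroup (C i) G"
  using internal_direct_sum by (simp add: internal_direct_sum_def)

lemma summand_carrier: "\<lbrakk>i \<in> I; x \<in> C i\<rbrakk> \<Longrightarrow> x \<in> carrier G"
  using additive_subgroup.a_subset[OF summand_subgroup] by blast

lemma summand_add: "\<lbrakk>i \<in> I; x \<in> C i; y \<in> C i\<rbrakk> \<Longrightarrow> x \<oplus> y \<in> C i"
  by (rule additive_subgroup.a_closed[OF summand_subgroup])

lemma unique_decomposition:
  assumes "x \<in> carrier G"
  shows "\<exists>!f. f \<in> (\<Pi>\<^sub>E i\<in>I. C i) \<and> finite {i \<in> I. f i \<noteq> \<zero>} \<and>
      x = (\<Oplus>i\<in>{i \<in> I. f i \<noteq> \<zero>}. f i)"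
  using internal_direct_sum assms by (simp add: internal_direct_sum_def)

lemma component_spec:
  assumes "x \<in> carrier G"
  shows "(\<lambda>i. component i x) \<in> (\<Pi>\<^sub>E i\<in>I. C i)"
    and "finite {i \<in> I. component i x \<noteq> \<zero>}"
    and "x = (\<Oplus>i\<in>{i \<in> I. component i x \<noteq> \<zero>}. component i x)"
  unfolding component_def using theI'[OF unique_decomposition[OF assms]]
  by - (elim conjE, assumption)+

lemma component_mem: "\<lbrakk>x \<in> carrier G; i \<in> I\<rbrakk> \<Longrightarrow> component i x \<in> C i"
  using component_spec(1) by blast

lemma component_closed: "\<lbrakk>x \<in> carrier G; i \<in> I\<rbrakk> \<Longrightarrow> component i x \<in> carrier G"
  using component_mem summand_carrier by blast

text \<open>Extending \<open>f\<close> by zero gives a decomposition of the sum, and by uniqueness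
  it is the family of components. The later rules for components all reduce to this one.\<close>

lemma component_finsum_summands:
  assumes "finite F" "F \<subseteq> I" "\<And>i. i \<in> F \<Longrightarrow> f i \<in> C i" "i \<in> I"
  shows "component i (\<Oplus>j\<in>F. f j) = (if i \<in> F then f i else \<zero>)"
proof -
  have fG: "f \<in> F \<rightarrow> carrier G"
    using assms(2,3) summand_carrier by blast
  \<comment> \<open>Inside \<open>I\<close> the extension is zero; outside it must be
    \<open>undefined\<close>, since uniqueness is stated for extensional families.\<close>
  define h where "h j = (if j \<in> F then f j else if j \<in> I then \<zero> else undefined)" for j
  have supp: "{j \<in> I. h j \<noteq> \<zero>} \<subseteq> F"
    by (auto simp: h_def split: if_splits)
  have h: "h \<in> (\<Pi>\<^sub>E i\<in>I. C i)"
    using assms(2,3) summand_subgroup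
    by (auto simp: h_def PiE_def extensional_def additive_subgroup.zero_closed)
  \<comment> \<open>Some \<open>f j\<close> may vanish, so the support of \<open>h\<close> can be
    smaller than \<open>F\<close>; only zero terms are dropped.\<close>
  have sum: "(\<Oplus>j\<in>F. f j) = (\<Oplus>j\<in>{j \<in> I. h j \<noteq> \<zero>}. h j)"
    by (rule add.finprod_mono_neutral_cong_right) (use assms supp fG in \<open>auto simp: h_def\<close>)
  have "h = (\<lambda>i. component i (\<Oplus>j\<in>F. f j))"
  proof (rule ex1E[OF unique_decomposition[OF finsum_closed[OF fG]]])
    fix k
    assume "\<forall>k'. k' \<in> (\<Pi>\<^sub>E i\<in>I. C i) \<and> finite {i \<in> I. k' i \<noteq> \<zero>} \<and>
      (\<Oplus>j\<in>F. f j) = (\<Oplus>i\<in>{i \<in> I. k' i \<noteq> \<zero>}. k' i) \<longrightarrow> k' = k"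
    then have uniq: "k' = k" if "k' \<in> (\<Pi>\<^sub>E i\<in>I. C i)" "finite {i \<in> I. k' i \<noteq> \<zero>}"
      "(\<Oplus>j\<in>F. f j) = (\<Oplus>i\<in>{i \<in> I. k' i \<noteq> \<zero>}. k' i)" for k'
      using that by blast
    have "h = k"
      by (rule uniq[OF h finite_subset[OF supp assms(1)] sum])
    moreover have "(\<lambda>i. component i (\<Oplus>j\<in>F. f j)) = k"
      by (rule uniq[OF component_spec[OF finsum_closed[OF fG]]])
    ultimately show ?thesis by simp
  qed
  then show ?thesis
    using assms(4) by (metis h_def)
qed

lemma component_summand:
  assumes "j \<in> I" "x \<in> C j" "i \<in> I"
  shows "component i x = (if j = i then x else \<zero>)"
  using component_finsum_summands[of "{j}" "\<lambda>_. x" i] assms summand_carrier by auto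

lemma component_zero: "i \<in> I \<Longrightarrow> component i \<zero> = \<zero>"
  using component_finsum_summands[of "{}" "\<lambda>_. \<zero>" i] by simp

text \<open>Over the union of the two supports both decompositions have the same index set, so they
  add termwise to a decomposition of \<open>x \<oplus> y\<close>.\<close>

lemma component_add:
  assumes "x \<in> carrier G" "y \<in> carrier G" "i \<in> I"
  shows "component i (x \<oplus> y) = component i x \<oplus> component i y"
proof -
  let ?X = "{i \<in> I. component i x \<noteq> \<zero>}" and ?Y = "{i \<in> I. component i y \<noteq> \<zero>}"
  let ?F = "?X \<union> ?Y"
  have fin: "finite ?F"
    using assms component_spec(2) by simp
  have closed: "(\<lambda>i. component i x) \<in> ?F \<rightarrow> carrier G" "(\<lambda>i. component i y) \<in> ?F \<rightarrow> carrier G"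
    using assms component_closed by auto
  have "(\<Oplus>i\<in>?X. component i x) = (\<Oplus>i\<in>?F. component i x)"
    by (rule add.finprod_mono_neutral_cong_left[OF fin _ _ _ closed(1)]) auto
  moreover have "(\<Oplus>i\<in>?Y. component i y) = (\<Oplus>i\<in>?F. component i y)"
    by (rule add.finprod_mono_neutral_cong_left[OF fin _ _ _ closed(2)]) auto
  ultimately have "x \<oplus> y = (\<Oplus>i\<in>?F. component i x) \<oplus> (\<Oplus>i\<in>?F. component i y)"
    by (intro arg_cong2[where f = "(\<oplus>)"] trans[OF component_spec(3)[OF assms(1)]]
        trans[OF component_spec(3)[OF assms(2)]])
  also have "\<dots> = (\<Oplus>i\<in>?F. component i x \<oplus> component i y)"
    using closed by (simp add: finsum_addf)
  finally have "component i (x \<oplus> y) = component i (\<Oplus>i\<in>?F. component i x \<oplus> component i y)"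
    by simp
  also have "\<dots> = (if i \<in> ?F then component i x \<oplus> component i y else \<zero>)"
    by (rule component_finsum_summands[OF fin])
      (use assms in \<open>auto intro!: summand_add component_mem\<close>)
  \<comment> \<open>Outside \<open>?F\<close> both components are zero, hence so is their
    sum.\<close>
  also have "\<dots> = component i x \<oplus> component i y"
    using assms(3) by auto
  finally show ?thesis .
qed

lemma component_finsum:
  assumes "finite A" "f \<in> A \<rightarrow> carrier G" "i \<in> I"
  shows "component i (\<Oplus>a\<in>A. f a) = (\<Oplus>a\<in>A. component i (f a))"
  using assms(1,2)
proof (induction A)
  case empty
  then show ?case using assms(3) by (simp add: component_zero)
next
  case (insert a A)
  then have "f \<in> A \<rightarrow> carrier G" "f a \<in> carrier G" by auto
  moreover from this have "(\<lambda>a. component i (f a)) \<in> A \<rightarrow> carrier G"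
    using assms(3) component_closed by auto
  ultimately show ?case
    using insert assms(3) component_closed by (simp add: component_add)
qed

end

subsection \<open>Spans and linear independence\<close>

context left_module
begin

section \<open>Scalar multiplication, zero and finite sums\<close>

lemma smult_l_null: "x \<in> carrier M \<Longrightarrow> \<zero>\<^bsub>R\<^esub> \<odot>\<^bsub>M\<^esub> x = \<zero>\<^bsub>M\<^esub>"
  using smult_l_distr[of "\<zero>\<^bsub>R\<^esub>" "\<zero>\<^bsub>R\<^esub>" x] M.add.l_cancel_one by fastforce

lemma smult_r_null: "a \<in> carrier R \<Longrightarrow> a \<odot>\<^bsub>M\<^esub> \<zero>\<^bsub>M\<^esub> = \<zero>\<^bsub>M\<^esub>"
  using smult_r_distr[of a "\<zero>\<^bsub>M\<^esub>" "\<zero>\<^bsub>M\<^esub>"] M.add.l_cancel_one by fastforce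

lemma finsum_smult_r:
  assumes "finite A" "f \<in> A \<rightarrow> carrier M" "a \<in> carrier R"
  shows "a \<odot>\<^bsub>M\<^esub> (\<Oplus>\<^bsub>M\<^esub>i\<in>A. f i) = (\<Oplus>\<^bsub>M\<^esub>i\<in>A. a \<odot>\<^bsub>M\<^esub> f i)"
  using assms(1,2)
proof (induction A)
  case empty
  then show ?case using assms(3) by (simp add: smult_r_null)
next
  case (insert i A)
  then have "f \<in> A \<rightarrow> carrier M" "f i \<in> carrier M" by auto
  moreover from this have "(\<lambda>i. a \<odot>\<^bsub>M\<^esub> f i) \<in> A \<rightarrow> carrier M"
    using assms(3) by auto
  ultimately show ?case
    using insert assms(3) by (simp add: smult_r_distr)
qed

lemma finsum_smult_l:
  assumes "finite A" "c \<in> A \<rightarrow> carrier R" "x \<in> carrier M"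
  shows "(\<Oplus>\<^bsub>R\<^esub>i\<in>A. c i) \<odot>\<^bsub>M\<^esub> x = (\<Oplus>\<^bsub>M\<^esub>i\<in>A. c i \<odot>\<^bsub>M\<^esub> x)"
  using assms(1,2)
proof (induction A)
  case empty
  then show ?case using assms(3) by (simp add: smult_l_null)
next
  case (insert i A)
  then have "c \<in> A \<rightarrow> carrier R" "c i \<in> carrier R" by auto
  moreover from this have "(\<lambda>i. c i \<odot>\<^bsub>M\<^esub> x) \<in> A \<rightarrow> carrier M"
    using assms(3) by auto
  ultimately show ?case
    using insert assms(3) by (simp add: smult_l_distr)
qed

section \<open>Spans as submodules\<close>

lemma lin_spanI:
  "\<lbrakk>finite A; A \<subseteq> S; c \<in> A \<rightarrow> carrier R\<rbrakk> \<Longrightarrow> (\<Oplus>\<^bsub>M\<^esub>x\<in>A. c x \<odot>\<^bsub>M\<^esub> x) \<in> lin_span R M S"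
  unfolding lin_span_def by blast

lemma lin_spanE:
  assumes "y \<in> lin_span R M S"
  obtains A c where "finite A" "A \<subseteq> S" "c \<in> A \<rightarrow> carrier R" "y = (\<Oplus>\<^bsub>M\<^esub>x\<in>A. c x \<odot>\<^bsub>M\<^esub> x)"
  using assms unfolding lin_span_def by blast

lemma lin_span_closed:
  assumes "S \<subseteq> carrier M"
  shows "lin_span R M S \<subseteq> carrier M"
  using assms by (auto elim!: lin_spanE intro!: M.finsum_closed)

lemma lin_span_superset:
  assumes "S \<subseteq> carrier M"
  shows "S \<subseteq> lin_span R M S"
proof
  fix x assume "x \<in> S"
  then show "x \<in> lin_span R M S"
    using lin_spanI[of "{x}" S "\<lambda>_. \<one>\<^bsub>R\<^esub>"] assms by (auto simp: subset_iff)
qed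

lemma lin_span_zero: "\<zero>\<^bsub>M\<^esub> \<in> lin_span R M S"
  using lin_spanI[of "{}" S "\<lambda>_. \<zero>\<^bsub>R\<^esub>"] by simp

lemma lin_span_add:
  assumes S: "S \<subseteq> carrier M" and "y \<in> lin_span R M S" "z \<in> lin_span R M S"
  shows "y \<oplus>\<^bsub>M\<^esub> z \<in> lin_span R M S"
proof -
  obtain A c where A: "finite A" "A \<subseteq> S" "c \<in> A \<rightarrow> carrier R" "y = (\<Oplus>\<^bsub>M\<^esub>x\<in>A. c x \<odot>\<^bsub>M\<^esub> x)"
    using assms(2) by (rule lin_spanE)
  obtain B d where B: "finite B" "B \<subseteq> S" "d \<in> B \<rightarrow> carrier R" "z = (\<Oplus>\<^bsub>M\<^esub>x\<in>B. d x \<odot>\<^bsub>M\<^esub> x)"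
    using assms(3) by (rule lin_spanE)
  \<comment> \<open>The two combinations may use different vectors; coefficients padded with zeros
    bring both to the index set \<open>A \<union> B\<close>.\<close>
  define c' where "c' x = (if x \<in> A then c x else \<zero>\<^bsub>R\<^esub>)" for x
  define d' where "d' x = (if x \<in> B then d x else \<zero>\<^bsub>R\<^esub>)" for x
  have coeffs: "c' x \<in> carrier R" "d' x \<in> carrier R" for x
    using A(3) B(3) by (auto simp: c'_def d'_def)
  have AB: "x \<in> carrier M" if "x \<in> A \<union> B" for x
    using that A(2) B(2) S by blast
  have closed: "(\<lambda>x. c' x \<odot>\<^bsub>M\<^esub> x) \<in> A \<union> B \<rightarrow> carrier M" "(\<lambda>x. d' x \<odot>\<^bsub>M\<^esub> x) \<in> A \<union> B \<rightarrow> carrier M"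
    using AB coeffs by blast+
  have "y = (\<Oplus>\<^bsub>M\<^esub>x\<in>A \<union> B. c' x \<odot>\<^bsub>M\<^esub> x)"
    unfolding A(4) by (rule M.add.finprod_mono_neutral_cong_left[OF _ _ _ _ closed(1)])
      (use A(1) B(1) AB in \<open>auto simp: c'_def smult_l_null\<close>)
  moreover have "z = (\<Oplus>\<^bsub>M\<^esub>x\<in>A \<union> B. d' x \<odot>\<^bsub>M\<^esub> x)"
    unfolding B(4) by (rule M.add.finprod_mono_neutral_cong_left[OF _ _ _ _ closed(2)])
      (use A(1) B(1) AB in \<open>auto simp: d'_def smult_l_null\<close>)
  ultimately have "y \<oplus>\<^bsub>M\<^esub> z = (\<Oplus>\<^bsub>M\<^esub>x\<in>A \<union> B. c' x \<odot>\<^bsub>M\<^esub> x \<oplus>\<^bsub>M\<^esub> d' x \<odot>\<^bsub>M\<^esub> x)"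
    using closed by (simp add: M.finsum_addf)
  also have "\<dots> = (\<Oplus>\<^bsub>M\<^esub>x\<in>A \<union> B. (c' x \<oplus>\<^bsub>R\<^esub> d' x) \<odot>\<^bsub>M\<^esub> x)"
    by (rule M.finsum_cong') (use AB coeffs in \<open>auto simp: smult_l_distr\<close>)
  finally show ?thesis
    using A B coeffs by (auto intro: lin_spanI)
qed

lemma lin_span_smult:
  assumes "S \<subseteq> carrier M" "a \<in> carrier R" "y \<in> lin_span R M S"
  shows "a \<odot>\<^bsub>M\<^esub> y \<in> lin_span R M S"
proof -
  obtain A c where A: "finite A" "A \<subseteq> S" "c \<in> A \<rightarrow> carrier R" "y = (\<Oplus>\<^bsub>M\<^esub>x\<in>A. c x \<odot>\<^bsub>M\<^esub> x)"
    using assms(3) by (rule lin_spanE)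
  have "a \<odot>\<^bsub>M\<^esub> y = (\<Oplus>\<^bsub>M\<^esub>x\<in>A. a \<odot>\<^bsub>M\<^esub> (c x \<odot>\<^bsub>M\<^esub> x))"
    unfolding A(4) by (rule finsum_smult_r) (use A assms in auto)
  also have "\<dots> = (\<Oplus>\<^bsub>M\<^esub>x\<in>A. (a \<otimes>\<^bsub>R\<^esub> c x) \<odot>\<^bsub>M\<^esub> x)"
    by (rule M.finsum_cong')
      (use A assms in \<open>auto simp: Pi_def subset_iff smult_assoc1\<close>)
  finally show ?thesis
    using A assms(2) by (auto intro!: lin_spanI)
qed

lemma lin_span_finsum:
  assumes "S \<subseteq> carrier M" "finite A" "f \<in> A \<rightarrow> lin_span R M S"
  shows "(\<Oplus>\<^bsub>M\<^esub>i\<in>A. f i) \<in> lin_span R M S"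
  using assms(2,3)
proof (induction A)
  case empty
  then show ?case by (simp add: lin_span_zero)
next
  case (insert i A)
  then have "f \<in> A \<rightarrow> lin_span R M S" "f i \<in> lin_span R M S" by auto
  moreover from this have "f \<in> A \<rightarrow> carrier M" "f i \<in> carrier M"
    using lin_span_closed[OF assms(1)] by auto
  ultimately show ?case
    using insert assms(1) by (simp add: lin_span_add)
qed

text \<open>Multiplying the relation by the negative inverse of \<open>a\<close> solves it for
  \<open>m\<close>.\<close>

lemma unit_multiple_mem_lin_span:
  assumes S: "S \<subseteq> carrier M" and m: "m \<in> carrier M" and a: "a \<in> Units R"
    and y: "y \<in> lin_span R M S" and eq: "a \<odot>\<^bsub>M\<^esub> m \<oplus>\<^bsub>M\<^esub> y = \<zero>\<^bsub>M\<^esub>"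
  shows "m \<in> lin_span R M S"
proof -
  define b where "b = \<ominus>\<^bsub>R\<^esub> (inv\<^bsub>R\<^esub> a)"
  have aR: "a \<in> carrier R" "inv\<^bsub>R\<^esub> a \<in> carrier R" "b \<in> carrier R"
    using a by (auto simp: b_def)
  have yM: "y \<in> carrier M"
    using y lin_span_closed[OF S] by blast
  have "b \<otimes>\<^bsub>R\<^esub> a = \<ominus>\<^bsub>R\<^esub> \<one>\<^bsub>R\<^esub>"
    using a aR by (simp add: b_def R.l_minus)
  then have "m \<oplus>\<^bsub>M\<^esub> b \<odot>\<^bsub>M\<^esub> (a \<odot>\<^bsub>M\<^esub> m) = (\<one>\<^bsub>R\<^esub> \<oplus>\<^bsub>R\<^esub> \<ominus>\<^bsub>R\<^esub> \<one>\<^bsub>R\<^esub>) \<odot>\<^bsub>M\<^esub> m"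
    using aR m by (simp add: smult_l_distr flip: smult_assoc1)
  then have "m \<oplus>\<^bsub>M\<^esub> b \<odot>\<^bsub>M\<^esub> (a \<odot>\<^bsub>M\<^esub> m) = \<zero>\<^bsub>M\<^esub>"
    using m by (simp add: R.r_neg smult_l_null)
  \<comment> \<open>Adding the zero element \<open>m + b (a m)\<close> to \<open>b y\<close> makes
    the relation \<open>a m + y = 0\<close> appear under the scalar \<open>b\<close>, and only
    \<open>m\<close> is left.\<close>
  then have "b \<odot>\<^bsub>M\<^esub> y = m \<oplus>\<^bsub>M\<^esub> b \<odot>\<^bsub>M\<^esub> (a \<odot>\<^bsub>M\<^esub> m) \<oplus>\<^bsub>M\<^esub> b \<odot>\<^bsub>M\<^esub> y"
    using aR yM by simp
  also have "\<dots> = m \<oplus>\<^bsub>M\<^esub> b \<odot>\<^bsub>M\<^esub> (a \<odot>\<^bsub>M\<^esub> m \<oplus>\<^bsub>M\<^esub> y)"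
    using aR yM m by (simp add: smult_r_distr M.a_assoc)
  also have "\<dots> = m"
    using aR m by (simp add: eq smult_r_null)
  finally show ?thesis
    using lin_span_smult[OF S aR(3) y] by simp
qed

section \<open>Linear independence and unions of chains\<close>

lemma lin_independent_empty: "lin_independent R M {}"
  by (simp add: lin_independent_def)

text \<open>A linear relation involves finitely many vectors, and a finite subset of the union of a
  non-empty chain lies in a single member of it.\<close>

lemma lin_independent_Union_chain:
  assumes "\<C> \<noteq> {}" "subset.chain \<A> \<C>" "\<And>S. S \<in> \<C> \<Longrightarrow> lin_independent R M S"
  shows "lin_independent R M (\<Union>\<C>)"
  unfolding lin_independent_def
proof (intro conjI allI impI)
  show "\<Union>\<C> \<subseteq> carrier M"
    using assms(3) by (auto simp: lin_independent_def)
next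
  fix A c
  assume A: "finite A \<and> A \<subseteq> \<Union>\<C> \<and> c \<in> A \<rightarrow> carrier R \<and> (\<Oplus>\<^bsub>M\<^esub>x\<in>A. c x \<odot>\<^bsub>M\<^esub> x) = \<zero>\<^bsub>M\<^esub>"
  then obtain S where "S \<in> \<C>" "A \<subseteq> S"
    using finite_subset_Union_chain[OF _ _ assms(1,2)] by blast
  then show "\<forall>x\<in>A. c x = \<zero>\<^bsub>R\<^esub>"
    using A assms(3) unfolding lin_independent_def by blast
qed

end

subsection \<open>Modules over graded division rings\<close>

text \<open>This collects the hypotheses of the theorem in one context. The name points to the
  analogy with vector spaces over a division ring.\<close>

locale graded_vector_space =
  left_module R M + graded_module \<Gamma> \<Gamma>' act R Rg M Mg + free_action \<Gamma> \<Gamma>' act + graded_division_ring \<Gamma> R Rg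
  for \<Gamma> :: "('g, 'w) monoid_scheme" and \<Gamma>' :: "'l set" and act :: "'g \<Rightarrow> 'l \<Rightarrow> 'l"
    and R :: "('r, 'u) ring_scheme" and Rg :: "'g \<Rightarrow> 'r set"
    and M :: "('r, 'm, 'v) module_scheme" and Mg :: "'l \<Rightarrow> 'm set"
begin

sublocale RC: direct_sum R "carrier \<Gamma>" Rg
  by unfold_locales (rule ring_direct_sum)

sublocale MC: direct_sum M \<Gamma>' Mg
  by unfold_locales (rule module_direct_sum)

section \<open>Homogeneous components of scalar multiples and of spans\<close>

lemma homogeneous_carrier: "homogeneous_elements \<Gamma>' Mg \<subseteq> carrier M"
  using MC.summand_carrier by (auto simp: homogeneous_elements_def)

text \<open>The part of \<open>c\<close> of degree \<open>h\<close> sends \<open>x\<close> into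
  degree \<open>act h l\<close>, so degree \<open>k\<close> collects the parts with
  \<open>act h l = k\<close>. The result is written as one scalar times \<open>x\<close> so that it
  visibly stays in every span containing \<open>x\<close>.\<close>

lemma component_smult:
  assumes c: "c \<in> carrier R" and l: "l \<in> \<Gamma>'" and x: "x \<in> Mg l" and k: "k \<in> \<Gamma>'"
  shows "MC.component k (c \<odot>\<^bsub>M\<^esub> x) =
    (\<Oplus>\<^bsub>R\<^esub>h\<in>{h \<in> carrier \<Gamma>. RC.component h c \<noteq> \<zero>\<^bsub>R\<^esub>}.
      if act h l = k then RC.component h c else \<zero>\<^bsub>R\<^esub>) \<odot>\<^bsub>M\<^esub> x"
    (is "_ = finsum R ?d ?H \<odot>\<^bsub>M\<^esub> x")
proof -
  have xM: "x \<in> carrier M"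
    using l x by (rule MC.summand_carrier)
  have fin: "finite ?H"
    using c by (rule RC.component_spec(2))
  have cR: "RC.component h c \<in> carrier R" "RC.component h c \<in> Rg h" if "h \<in> ?H" for h
    using that c RC.component_closed RC.component_mem by auto
  have "c \<odot>\<^bsub>M\<^esub> x = (\<Oplus>\<^bsub>R\<^esub>h\<in>?H. RC.component h c) \<odot>\<^bsub>M\<^esub> x"
    using RC.component_spec(3)[OF c] by simp
  also have "\<dots> = (\<Oplus>\<^bsub>M\<^esub>h\<in>?H. RC.component h c \<odot>\<^bsub>M\<^esub> x)"
    by (rule finsum_smult_l) (use fin cR xM in auto)
  finally have "MC.component k (c \<odot>\<^bsub>M\<^esub> x) = (\<Oplus>\<^bsub>M\<^esub>h\<in>?H. MC.component k (RC.component h c \<odot>\<^bsub>M\<^esub> x))"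
    using MC.component_finsum[of ?H "\<lambda>h. RC.component h c \<odot>\<^bsub>M\<^esub> x" k] fin cR xM k by auto
  also have "\<dots> = (\<Oplus>\<^bsub>M\<^esub>h\<in>?H. ?d h \<odot>\<^bsub>M\<^esub> x)"
  proof (rule M.finsum_cong')
    fix h assume h: "h \<in> ?H"
    \<comment> \<open>Each term is homogeneous of degree \<open>act h l\<close>, so its component in
      degree \<open>k\<close> is either the whole term or zero.\<close>
    then have "RC.component h c \<odot>\<^bsub>M\<^esub> x \<in> Mg (act h l)"
      using graded_smult cR(2) l x by blast
    moreover have "act h l \<in> \<Gamma>'"
      using element_image[of h l] h l by simp
    ultimately show "MC.component k (RC.component h c \<odot>\<^bsub>M\<^esub> x) = ?d h \<odot>\<^bsub>M\<^esub> x"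
      using MC.component_summand k xM by (simp add: smult_l_null)
  qed (use cR xM in auto)
  also have "\<dots> = finsum R ?d ?H \<odot>\<^bsub>M\<^esub> x"
    by (rule finsum_smult_l[symmetric]) (use fin cR xM in auto)
  finally show ?thesis .
qed

text \<open>Freeness makes \<open>h = g\<close> the only solution of
  \<open>act h l = act g l\<close>, so the sum in \<open>component_smult\<close> collapses to one
  term.\<close>

lemma component_smult_free:
  assumes c: "c \<in> carrier R" and l: "l \<in> \<Gamma>'" and x: "x \<in> Mg l" and g: "g \<in> carrier \<Gamma>"
    and nz: "RC.component g c \<noteq> \<zero>\<^bsub>R\<^esub>"
  shows "MC.component (act g l) (c \<odot>\<^bsub>M\<^esub> x) = RC.component g c \<odot>\<^bsub>M\<^esub> x"
proof -
  let ?H = "{h \<in> carrier \<Gamma>. RC.component h c \<noteq> \<zero>\<^bsub>R\<^esub>}"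
  have gl: "act g l \<in> \<Gamma>'"
    using element_image[of g l] g l by simp
  have eq: "act h l = act g l \<longleftrightarrow> h = g" if "h \<in> ?H" for h
    using that free[of h g l] g l by auto
  have cR: "RC.component h c \<in> carrier R" if "h \<in> ?H" for h
    using that c RC.component_closed by auto
  have "(\<Oplus>\<^bsub>R\<^esub>h\<in>?H. if act h l = act g l then RC.component h c else \<zero>\<^bsub>R\<^esub>) =
      (\<Oplus>\<^bsub>R\<^esub>h\<in>?H. if h = g then RC.component h c else \<zero>\<^bsub>R\<^esub>)"
    by (rule R.finsum_cong') (use eq cR in auto)
  \<comment> \<open>By \<open>nz\<close> the index \<open>g\<close> belongs to \<open>?H\<close>, so
    its term does occur in the sum.\<close>
  also have "\<dots> = RC.component g c"
    by (rule R.add.finprod_singleton_swap) (use g nz cR RC.component_spec(2)[OF c] in auto)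
  finally show ?thesis
    by (simp add: component_smult[OF c l x gl])
qed

text \<open>In other words, homogeneous vectors span a graded submodule: by
  \<open>component_smult\<close>, each component of a multiple of \<open>x\<close> is again a
  multiple of \<open>x\<close>.\<close>

lemma component_lin_span:
  assumes B: "B \<subseteq> homogeneous_elements \<Gamma>' Mg" and k: "k \<in> \<Gamma>'" and y: "y \<in> lin_span R M B"
  shows "MC.component k y \<in> lin_span R M B"
proof -
  have BM: "B \<subseteq> carrier M"
    using B homogeneous_carrier by blast
  obtain A c where A: "finite A" "A \<subseteq> B" "c \<in> A \<rightarrow> carrier R" "y = (\<Oplus>\<^bsub>M\<^esub>x\<in>A. c x \<odot>\<^bsub>M\<^esub> x)"
    using y by (rule lin_spanE)
  have "MC.component k y = (\<Oplus>\<^bsub>M\<^esub>x\<in>A. MC.component k (c x \<odot>\<^bsub>M\<^esub> x))"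
    unfolding A(4) by (rule MC.component_finsum) (use A BM k in auto)
  moreover have "MC.component k (c x \<odot>\<^bsub>M\<^esub> x) \<in> lin_span R M B" if "x \<in> A" for x
  proof -
    obtain l where l: "l \<in> \<Gamma>'" "x \<in> Mg l"
      using \<open>x \<in> A\<close> A(2) B by (auto simp: homogeneous_elements_def)
    have cx: "c x \<in> carrier R"
      using \<open>x \<in> A\<close> A(3) by blast
    show ?thesis
      unfolding component_smult[OF cx l k]
      by (rule lin_span_smult[OF BM])
        (use \<open>x \<in> A\<close> A(2) lin_span_superset[OF BM] RC.component_closed[OF cx] in
          \<open>auto intro!: R.finsum_closed\<close>)
  qed
  ultimately show ?thesis
    using lin_span_finsum[OF BM A(1)] by auto
qed

text \<open>If \<open>m\<close> had a non-zero coefficient in a relation, some homogeneous component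
  of the relation could be solved for \<open>m\<close>, contrary to \<open>notin\<close>. So the
  coefficient is zero, and what remains is a relation within \<open>B\<close>.\<close>

lemma lin_independent_insert:
  assumes B: "lin_independent R M B" "B \<subseteq> homogeneous_elements \<Gamma>' Mg"
    and l: "l \<in> \<Gamma>'" and m: "m \<in> Mg l" and notin: "m \<notin> lin_span R M B"
  shows "lin_independent R M (insert m B)"
  unfolding lin_independent_def
proof (intro conjI allI impI)
  have mM: "m \<in> carrier M"
    using l m by (rule MC.summand_carrier)
  have BM: "B \<subseteq> carrier M"
    using B(2) homogeneous_carrier by blast
  then show "insert m B \<subseteq> carrier M"
    using mM by simp
  fix A c
  assume A: "finite A \<and> A \<subseteq> insert m B \<and> c \<in> A \<rightarrow> carrier R \<and> (\<Oplus>\<^bsub>M\<^esub>x\<in>A. c x \<odot>\<^bsub>M\<^esub> x) = \<zero>\<^bsub>M\<^esub>"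
  have indep: "\<forall>x\<in>A'. c x = \<zero>\<^bsub>R\<^esub>"
    if "finite A'" "A' \<subseteq> B" "c \<in> A' \<rightarrow> carrier R" "(\<Oplus>\<^bsub>M\<^esub>x\<in>A'. c x \<odot>\<^bsub>M\<^esub> x) = \<zero>\<^bsub>M\<^esub>" for A'
    using B(1) that unfolding lin_independent_def by blast
  show "\<forall>x\<in>A. c x = \<zero>\<^bsub>R\<^esub>"
  proof (cases "m \<in> A")
    case False
    then show ?thesis using A by (intro indep) auto
  next
    case True
    define A' where "A' = A - {m}"
    have A': "finite A'" "A' \<subseteq> B" "c \<in> A' \<rightarrow> carrier R" "m \<notin> A'" "A = insert m A'"
      using A True by (auto simp: A'_def)
    have cm: "c m \<in> carrier R"
      using A True by blast
    define y where "y = (\<Oplus>\<^bsub>M\<^esub>x\<in>A'. c x \<odot>\<^bsub>M\<^esub> x)"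
    have y: "y \<in> lin_span R M B"
      unfolding y_def using A'(1-3) by (rule lin_spanI)
    then have yM: "y \<in> carrier M"
      using lin_span_closed[OF BM] by blast
    have "(\<lambda>x. c x \<odot>\<^bsub>M\<^esub> x) \<in> A' \<rightarrow> carrier M"
      using A'(2,3) BM by auto
    then have "(\<Oplus>\<^bsub>M\<^esub>x\<in>A. c x \<odot>\<^bsub>M\<^esub> x) = c m \<odot>\<^bsub>M\<^esub> m \<oplus>\<^bsub>M\<^esub> y"
      unfolding A'(5) y_def using A'(1,4) cm mM by simp
    then have eq: "c m \<odot>\<^bsub>M\<^esub> m \<oplus>\<^bsub>M\<^esub> y = \<zero>\<^bsub>M\<^esub>"
      using A by simp
    \<comment> \<open>Only homogeneous non-zero scalars are known to be units, so the relation
      cannot be divided by \<open>c m\<close> itself; a non-zero component of \<open>c m\<close>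
      takes its place.\<close>
    have cm0: "c m = \<zero>\<^bsub>R\<^esub>"
    proof (rule ccontr)
      assume "c m \<noteq> \<zero>\<^bsub>R\<^esub>"
      \<comment> \<open>If every component vanished, \<open>c m\<close> would be an empty sum, that
        is, zero.\<close>
      then have "{g \<in> carrier \<Gamma>. RC.component g (c m) \<noteq> \<zero>\<^bsub>R\<^esub>} \<noteq> {}"
        using RC.component_spec(3)[OF cm] R.finsum_empty by metis
      then obtain g where g: "g \<in> carrier \<Gamma>" "RC.component g (c m) \<noteq> \<zero>\<^bsub>R\<^esub>"
        by blast
      have gl: "act g l \<in> \<Gamma>'"
        using element_image[of g l] g l by simp
      \<comment> \<open>The degree \<open>act g l\<close> is chosen so that the term of
        \<open>m\<close> contributes exactly the component of \<open>c m\<close> at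
        \<open>g\<close>, while the rest stays in the span of \<open>B\<close>.\<close>
      have "MC.component (act g l) (c m \<odot>\<^bsub>M\<^esub> m) \<oplus>\<^bsub>M\<^esub> MC.component (act g l) y = \<zero>\<^bsub>M\<^esub>"
        using MC.component_add[of "c m \<odot>\<^bsub>M\<^esub> m" y "act g l"] MC.component_zero[OF gl] eq cm mM yM gl
        by simp
      then have "RC.component g (c m) \<odot>\<^bsub>M\<^esub> m \<oplus>\<^bsub>M\<^esub> MC.component (act g l) y = \<zero>\<^bsub>M\<^esub>"
        by (simp add: component_smult_free[OF cm l m g])
      moreover have "RC.component g (c m) \<in> Units R"
        using homogeneous_Units g RC.component_mem[OF cm] by blast
      ultimately show False
        using unit_multiple_mem_lin_span[OF BM mM] component_lin_span[OF B(2) gl y] notin by blast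
    qed
    then have "y = \<zero>\<^bsub>M\<^esub>"
      using eq mM yM by (simp add: smult_l_null)
    then have "\<forall>x\<in>A'. c x = \<zero>\<^bsub>R\<^esub>"
      using indep A'(1-3) by (simp add: y_def)
    then show ?thesis
      using A'(5) cm0 by simp
  qed
qed

text \<open>Every element is the finite sum of its homogeneous components, so it suffices that the
  span contains the homogeneous elements.\<close>

lemma lin_span_eq_carrier:
  assumes B: "B \<subseteq> carrier M" and "homogeneous_elements \<Gamma>' Mg \<subseteq> lin_span R M B"
  shows "lin_span R M B = carrier M"
proof
  show "lin_span R M B \<subseteq> carrier M"
    using B by (rule lin_span_closed)
  show "carrier M \<subseteq> lin_span R M B"
  proof
    fix x assume x: "x \<in> carrier M"
    have "(\<Oplus>\<^bsub>M\<^esub>l\<in>{l \<in> \<Gamma>'. MC.component l x \<noteq> \<zero>\<^bsub>M\<^esub>}. MC.component l x) \<in> lin_span R M B"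
      by (rule lin_span_finsum[OF B MC.component_spec(2)[OF x]])
        (use assms(2) MC.component_mem[OF x] in \<open>auto simp: homogeneous_elements_def\<close>)
    then show "x \<in> lin_span R M B"
      using MC.component_spec(3)[OF x] by simp
  qed
qed

lemma extend_to_homogeneous_basis:
  assumes "lin_independent R M S" "S \<subseteq> homogeneous_elements \<Gamma>' Mg"
  obtains B where "S \<subseteq> B" "homogeneous_basis R M \<Gamma>' Mg B"
proof -
  let ?P = "{B. S \<subseteq> B \<and> lin_independent R M B \<and> B \<subseteq> homogeneous_elements \<Gamma>' Mg}"
  \<comment> \<open>Zorn's lemma for inclusion; \<open>S\<close> itself shows that \<open>?P\<close>
    is not empty.\<close>
  have "\<exists>B\<in>?P. \<forall>B'\<in>?P. B \<subseteq> B' \<longrightarrow> B' = B"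
  proof (rule subset_Zorn_nonempty)
    show "?P \<noteq> {}"
      using assms by blast
    fix \<C> assume \<C>: "\<C> \<noteq> {}" "subset.chain ?P \<C>"
    then have sub: "\<C> \<subseteq> ?P"
      by (simp add: subset.chain_def)
    then have "lin_independent R M (\<Union>\<C>)"
      using lin_independent_Union_chain[OF \<C>] by blast
    \<comment> \<open>The union contains \<open>S\<close> because the chain has at least one
      member.\<close>
    then show "\<Union>\<C> \<in> ?P"
      using sub \<C>(1) by blast
  qed
  then obtain B where "B \<in> ?P" and max: "\<forall>B'\<in>?P. B \<subseteq> B' \<longrightarrow> B' = B"
    by (rule bexE)
  then have B: "S \<subseteq> B" "lin_independent R M B" "B \<subseteq> homogeneous_elements \<Gamma>' Mg"
    by simp_all
  have BM: "B \<subseteq> carrier M"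
    using B(3) homogeneous_carrier by blast
  have "homogeneous_elements \<Gamma>' Mg \<subseteq> lin_span R M B"
  proof
    fix m assume m: "m \<in> homogeneous_elements \<Gamma>' Mg"
    then obtain l where l: "l \<in> \<Gamma>'" "m \<in> Mg l"
      by (auto simp: homogeneous_elements_def)
    show "m \<in> lin_span R M B"
    proof (rule ccontr)
      assume notin: "m \<notin> lin_span R M B"
      \<comment> \<open>The enlarged set is still independent and homogeneous, so maximality puts
        \<open>m\<close> into \<open>B\<close> and hence into its span.\<close>
      then have "insert m B = B"
        using lin_independent_insert[OF B(2,3) l] B m by (intro max[rule_format]) auto
      then show False
        using notin lin_span_superset[OF BM] by blast
    qed
  qed
  then have "homogeneous_basis R M \<Gamma>' Mg B"
    using lin_span_eq_carrier[OF BM] B by (simp add: homogeneous_basis_def module_basis_def)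
  then show ?thesis
    using that B(1) by blast
qed

end

theorem proposition4p2p4:
  fixes \<Gamma> :: "('g, 'w) monoid_scheme" and \<Gamma>' :: "'l set" and act :: "'g \<Rightarrow> 'l \<Rightarrow> 'l"
    and R :: "('r, 'u) ring_scheme" and Rg :: "'g \<Rightarrow> 'r set"
    and M :: "('r, 'm, 'v) module_scheme" and Mg :: "'l \<Rightarrow> 'm set"
  assumes "free_action \<Gamma> \<Gamma>' act"
    and "graded_division_ring \<Gamma> R Rg"
    and "graded_module \<Gamma> \<Gamma>' act R Rg M Mg"
  shows "graded_free R M \<Gamma>' Mg \<and>
    (\<forall>S. lin_independent R M S \<and> S \<subseteq> homogeneous_elements \<Gamma>' Mg \<longrightarrow>
      (\<exists>B. S \<subseteq> B \<and> homogeneous_basis R M \<Gamma>' Mg B))"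
proof -
  interpret graded_vector_space \<Gamma> \<Gamma>' act R Rg M Mg
    by (rule graded_vector_space.intro[OF graded_module.axioms(3)[OF assms(3)] assms(3,1,2)])
  have extend: "\<exists>B. S \<subseteq> B \<and> homogeneous_basis R M \<Gamma>' Mg B"
    if "lin_independent R M S" "S \<subseteq> homogeneous_elements \<Gamma>' Mg" for S
    by (rule extend_to_homogeneous_basis[OF that]) (intro exI conjI)
  \<comment> \<open>Graded freeness is the case \<open>S = {}\<close> of the extension
    property.\<close>
  have "graded_free R M \<Gamma>' Mg"
    using extend[OF lin_independent_empty] by (auto simp: graded_free_def)
  with extend show ?thesis
    by simp
qed

end
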